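(* Let $\mathcal{C}$ be a class of finite simple undirected graphs. Then $\mathcal{C}$ is both weakly sparse and strongly flip-flat if and only if $\mathcal{C}$ is uniformly almost-wide.
   Context: $\mathbb{N}$ denotes the positive integers. For a graph $G$ and $S\subseteq V(G)$, $G\setminus S$ is the subgraph induced by $V(G)\setminus S$. A set $B\subseteq V(G)$ is $r$-independent in $G$ if every two distinct vertices of $B$ are at distance strictly greater than $r$ in $G$. $K_{t,t}$ is the complete bipartite graph with $t$ vertices on each side. A class $\mathcal{C}$ is weakly sparse if there is $t\in\mathbb{N}$ such that no graph of $\mathcal{C}$ contains $K_{t,t}$ as a subgraph. A flip in $G$ is a pair $F=(A,B)$ of subsets of $V(G)$ (possibly intersecting or equal); $G\oplus F$ is the graph on $V(G)$ whose edge set is $E(G)\,\Delta\,((A\times B)\cup(B\times A))$ (i.e. adjacency between every vertex of $A$ and every other vertex of $B$ is complemented). For a set of flips $\mathcal{F}=\{F_1,\dots,F_k\}$, $G\oplus\mathcal{F}=G\oplus F_1\oplus\cdots\oplus F_k$. $\mathcal{C}$ is strongly flip-flat if there is an integer $s$ such that for every $r\in\mathbb{N}$ there is a function $N_r:\mathbb{N}\to\mathbb{N}$ such that for all $m\in\mathbb{N}$, all $G\in\mathcal{C}$ and all $A\subseteq V(G)$ with $|A|\ge N_r(m)$, there are a set of flips $\mathcal{F}$ with $|\mathcal{F}|\le s$ and $B\subseteq A$ with $|B|\ge m$ such that $B$ is $r$-independent in $G\oplus\mathcal{F}$. $\mathcal{C}$ is uniformly almost-wide if there is an integer $s$ such that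 for every $r\in\mathbb{N}$ there is a function $N_r:\mathbb{N}\to\mathbb{N}$ such that for all $m\in\mathbb{N}$, all $G\in\mathcal{C}$ and all $A\subseteq V(G)$ with $|A|\ge N_r(m)$, there are $S\subseteq V(G)$ with $|S|\le s$ and $B\subseteq A\setminus S$ with $|B|> m$ such that $B$ is $r$-independent in $G\setminus S$. *)

theory Defs
  imports "Graph_Theory.Graph_Theory"
begin

text \<open>
  A finite simple undirected graph is a \<open>pair_pre_digraph\<close> satisfying \<open>pair_graph\<close>: the arc set is
  a finite, symmetric, irreflexive relation on a finite vertex set. The positive integers are
  rendered as the subset \<open>{1..}\<close> of the type \<open>nat\<close>.
\<close>

text \<open>The distance is \<open>\<infinity>\<close> for vertices in different components.\<close>

definition graph_dist :: "('a, 'b) pre_digraph \<Rightarrow> 'a \<Rightarrow> 'a \<Rightarrow> ereal" where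
  "graph_dist G u v = wf_digraph.\<mu> G (\<lambda>_. 1) u v"

definition r_independent :: "nat \<Rightarrow> ('a, 'b) pre_digraph \<Rightarrow> 'a set \<Rightarrow> bool" where
  "r_independent r G B \<longleftrightarrow>
     B \<subseteq> verts G \<and> (\<forall>u\<in>B. \<forall>v\<in>B. u \<noteq> v \<longrightarrow> graph_dist G u v > ereal (real r))"

definition delete_verts :: "('a, 'b) pre_digraph \<Rightarrow> 'a set \<Rightarrow> ('a, 'b) pre_digraph" where
  "delete_verts G S = G \<restriction> (verts G - S)"

definition weakly_sparse :: "'a pair_pre_digraph set \<Rightarrow> bool" where
  "weakly_sparse \<C> \<longleftrightarrow>
     (\<exists>t\<ge>1. \<forall>G\<in>\<C>. \<not> (\<exists>H. subgraph H (with_proj G) \<and> complete_bipartite_digraph t t H))"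

definition is_flip :: "'a pair_pre_digraph \<Rightarrow> 'a set \<times> 'a set \<Rightarrow> bool" where
  "is_flip G F \<longleftrightarrow> fst F \<subseteq> pverts G \<and> snd F \<subseteq> pverts G"

text \<open>The diagonal is removed because only pairs of distinct vertices are complemented, also when
  the two sides of the flip intersect.\<close>

definition flip :: "'a set \<times> 'a set \<Rightarrow> 'a pair_pre_digraph \<Rightarrow> 'a pair_pre_digraph" where
  "flip F G = G\<lparr> parcs := sym_diff (parcs G) ((fst F \<times> snd F \<union> snd F \<times> fst F) - Id) \<rparr>"

text \<open>Applies the flips of a finite set one after another; by \<open>comp_fun_commute_flip\<close> below the
  order is irrelevant.\<close>

definition flips :: "('a set \<times> 'a set) set \<Rightarrow> 'a pair_pre_digraph \<Rightarrow> 'a pair_pre_digraph" where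
  "flips \<F> G = Finite_Set.fold flip G \<F>"

definition strongly_flip_flat :: "'a pair_pre_digraph set \<Rightarrow> bool" where
  "strongly_flip_flat \<C> \<longleftrightarrow>
     (\<exists>s::nat. \<forall>r\<ge>1. \<exists>N \<in> {1::nat..} \<rightarrow> {1::nat..}. \<forall>m\<ge>1. \<forall>G\<in>\<C>. \<forall>A\<subseteq>pverts G.
        card A \<ge> N m \<longrightarrow>
        (\<exists>\<F> B. finite \<F> \<and> card \<F> \<le> s \<and> (\<forall>F\<in>\<F>. is_flip G F) \<and>
               B \<subseteq> A \<and> card B \<ge> m \<and> r_independent r (with_proj (flips \<F> G)) B))"

definition uniformly_almost_wide :: "'a pair_pre_digraph set \<Rightarrow> bool" where
  "uniformly_almost_wide \<C> \<longleftrightarrow>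
     (\<exists>s::nat. \<forall>r\<ge>1. \<exists>N \<in> {1::nat..} \<rightarrow> {1::nat..}. \<forall>m\<ge>1. \<forall>G\<in>\<C>. \<forall>A\<subseteq>pverts G.
        card A \<ge> N m \<longrightarrow>
        (\<exists>S B. S \<subseteq> pverts G \<and> card S \<le> s \<and>
               B \<subseteq> A - S \<and> card B > m \<and> r_independent r (delete_verts (with_proj G) S) B))"

lemma comp_fun_commute_flip: "comp_fun_commute flip"
proof
  fix F F' :: "'a set \<times> 'a set"
  have "sym_diff (sym_diff E X) Y = sym_diff (sym_diff E Y) X" for E X Y :: "'a rel"
    by blast
  then show "flip F' \<circ> flip F = flip F \<circ> flip F'"
    by (simp add: flip_def fun_eq_iff)
qed

lemma flips_empty [simp]: "flips {} G = G"
  by (simp add: flips_def)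

lemma flips_insert:
  assumes "finite \<F>" "F \<notin> \<F>"
  shows "flips (insert F \<F>) G = flip F (flips \<F> G)"
  using assms by (simp add: flips_def comp_fun_commute_on.fold_insert
      [OF comp_fun_commute_flip[unfolded comp_fun_commute_def']])

lemma pverts_flip [simp]: "pverts (flip F G) = pverts G"
  by (simp add: flip_def)

lemma pair_graph_flip:
  assumes "pair_graph G" "is_flip G F"
  shows "pair_graph (flip F G)"
proof -
  interpret pair_graph G by fact
  have V: "fst F \<subseteq> pverts G" "snd F \<subseteq> pverts G"
    using assms(2) by (auto simp: is_flip_def)
  have sub: "parcs (flip F G) \<subseteq> pverts G \<times> pverts G"
    using V by (auto simp: flip_def dest: wellformed')
  have "finite (parcs (flip F G))"
    using sub finite_subset pair_finite_verts by blast
  moreover have "sym (parcs (flip F G))"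
    using pair_sym_arcs by (auto simp: flip_def symmetric_def sym_def)
  moreover have "fst e \<noteq> snd e" if "e \<in> parcs (flip F G)" for e
    using that pair_no_loops by (auto simp: flip_def)
  ultimately show ?thesis
    using sub pair_finite_verts by unfold_locales (auto simp: symmetric_def)
qed

lemma pair_graph_flips:
  assumes "finite \<F>" "pair_graph G" "\<forall>F\<in>\<F>. is_flip G F"
  shows "pair_graph (flips \<F> G) \<and> pverts (flips \<F> G) = pverts G"
  using assms
  by (induction \<F> rule: finite_induct)
     (auto simp: flips_insert is_flip_def intro!: pair_graph_flip)

lemma graph_dist_eq:
  assumes "wf_digraph G"
  shows "graph_dist G u v = (INF p\<in>{p. pre_digraph.awalk G u p v}. ereal (real (length p)))"
  using assms
  by (simp add: graph_dist_def wf_digraph.\<mu>_def wf_digraph.awalk_cost_def sum_list_triv)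

end

theory Submission
  imports Defs
begin

text \<open>
  At most \<open>s\<close> flips split the vertices into at most \<open>4 ^ s\<close> cells such that between two cells the
  adjacency is either kept or complemented as a whole. Let \<open>B\<close> be \<open>(2 r + 2)\<close>-independent in the
  flipped graph and, by pigeonhole over the sets of cells, such that the \<open>r\<close>-balls around its
  points meet the same cells. If such a cell is complemented against a cell \<open>Y\<close>, choose one
  representative of it in each of the disjoint balls. Every vertex of \<open>Y\<close> is adjacent in \<open>G\<close> to
  all representatives but at most one, so excluding \<open>K\<^bsub>t,t\<^esub>\<close> forces \<open>Y\<close> to have fewer than \<open>t\<close>
  vertices. Hence, once all cells with fewer than \<open>t\<close> vertices are deleted, at most \<open>t * 4 ^ s\<close>
  vertices whatever \<open>r\<close> is, walks of length at most \<open>r\<close> starting in \<open>B\<close> are walks of the flipped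
  graph. Conversely, a deleted set is simulated by flips that cut off its vertices one by one, and
  two vertices on one side of a large biclique stay at distance two after few deletions.
\<close>

section \<open>Scattered sets\<close>

lemma sym_relpow: "sym R \<Longrightarrow> sym (R ^^ n)"
  by (induction n) (simp_all add: sym_conv_converse_eq converse_relcomp relpow_commute)

lemma relpow_reflcl_mono: "m \<le> n \<Longrightarrow> (R\<^sup>=) ^^ m \<subseteq> (R\<^sup>=) ^^ n"
  by (induction rule: dec_induct) auto

lemma relpow_reflcl_closed:
  assumes "R `` X \<subseteq> X" "x \<in> X" "(x, y) \<in> (R\<^sup>=) ^^ n"
  shows "y \<in> X"
  using assms(3)
proof (induction n arbitrary: y)
  case 0
  with assms(2) show ?case by simp
next
  case (Suc n)
  then obtain z where "(x, z) \<in> (R\<^sup>=) ^^ n" "(z, y) \<in> R\<^sup>="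
    by auto
  with Suc.IH[of z] assms(1) show ?case by auto
qed

text \<open>The reflexive closure turns walks of length exactly \<open>r\<close> into walks of length at most \<open>r\<close>.\<close>

definition scattered :: "nat \<Rightarrow> 'a rel \<Rightarrow> 'a set \<Rightarrow> bool" where
  "scattered r R B \<longleftrightarrow> pairwise (\<lambda>u v. (u, v) \<notin> (R\<^sup>=) ^^ r) B"

lemma scatteredD: "scattered r R B \<Longrightarrow> u \<in> B \<Longrightarrow> v \<in> B \<Longrightarrow> (u, v) \<in> (R\<^sup>=) ^^ r \<Longrightarrow> u = v"
  by (auto simp: scattered_def pairwise_def)

lemma scattered_subset: "scattered r R B \<Longrightarrow> A \<subseteq> B \<Longrightarrow> scattered r R A"
  unfolding scattered_def by (rule pairwise_subset)

lemma scattered_antimono: "scattered n R B \<Longrightarrow> m \<le> n \<Longrightarrow> scattered m R B"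
  using relpow_reflcl_mono[of m n R] by (auto simp: scattered_def pairwise_def)

lemma scattered_transfer:
  assumes "scattered r R' B"
    and ball: "\<And>b x y. b \<in> B \<Longrightarrow> (b, x) \<in> (R'\<^sup>=) ^^ r \<Longrightarrow> (x, y) \<in> R \<Longrightarrow> (x, y) \<in> R'\<^sup>="
  shows "scattered r R B"
proof -
  have "(b, v) \<in> (R'\<^sup>=) ^^ n" if "b \<in> B" "(b, v) \<in> (R\<^sup>=) ^^ n" "n \<le> r" for b v n
    using that(2,3)
  proof (induction n arbitrary: v)
    case (Suc n)
    then obtain x where x: "(b, x) \<in> (R'\<^sup>=) ^^ n" "(x, v) \<in> R\<^sup>="
      by auto
    then have "(b, x) \<in> (R'\<^sup>=) ^^ r"
      using Suc.prems(2) relpow_reflcl_mono[of n r R'] by auto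
    with x(2) have "(x, v) \<in> R'\<^sup>="
      using ball[OF \<open>b \<in> B\<close>] by auto
    with x(1) show ?case by auto
  qed simp
  with assms(1) show ?thesis
    unfolding scattered_def pairwise_def by blast
qed

lemma scattered_nearby_image:
  assumes "sym R" "scattered (i + n + i) R B" and near: "\<And>b. b \<in> B \<Longrightarrow> (b, f b) \<in> (R\<^sup>=) ^^ i"
  shows "inj_on f B" "scattered n R (f ` B)"
proof -
  have return: "(f b, b) \<in> (R\<^sup>=) ^^ i" if "b \<in> B" for b
    using sym_relpow[of "R\<^sup>="] assms(1) near[OF that] by (auto intro: sym_Un sym_Id dest: symD)
  have eq: "b = b'" if "b \<in> B" "b' \<in> B" "(f b, f b') \<in> (R\<^sup>=) ^^ n" for b b'
  proof -
    have "(b, b') \<in> (R\<^sup>=) ^^ (i + n + i)"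
      using near[OF that(1)] that(3) return[OF that(2)] by (blast intro: relpow_trans)
    with assms(2) that(1,2) show ?thesis
      by (rule scatteredD)
  qed
  have "(x, x) \<in> (R\<^sup>=) ^^ n" for x
    using relpow_reflcl_mono[of 0 n R] by auto
  with eq show "inj_on f B"
    by (metis inj_onI)
  from eq show "scattered n R (f ` B)"
    by (auto simp: scattered_def pairwise_def)
qed

lemma card_neighbours_in_scattered_le:
  assumes "sym R" "scattered 2 R X"
  shows "card {x \<in> X. (x, y) \<in> R\<^sup>=} \<le> 1"
proof (cases "finite {x \<in> X. (x, y) \<in> R\<^sup>=}")
  case True
  have "x = x'" if "x \<in> X" "x' \<in> X" "(x, y) \<in> R\<^sup>=" "(x', y) \<in> R\<^sup>=" for x x'
  proof -
    have "(y, x') \<in> R\<^sup>="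
      using that(4) assms(1) by (auto dest: symD)
    with that(3) have "(x, x') \<in> (R\<^sup>=) ^^ 2"
      by (auto simp: numeral_2_eq_2)
    with assms(2) that(1,2) show ?thesis
      by (rule scatteredD)
  qed
  with True show ?thesis
    unfolding One_nat_def by (subst card_le_Suc0_iff_eq) auto
qed simp

context wf_digraph
begin

lemma awalk_imp_relpow_reflcl: "awalk u p v \<Longrightarrow> (u, v) \<in> ((arcs_ends G)\<^sup>=) ^^ length p"
proof (induction p arbitrary: u)
  case Nil
  then show ?case by (simp add: awalk_Nil_iff)
next
  case (Cons e p)
  then have "(u, head G e) \<in> (arcs_ends G)\<^sup>=" "(head G e, v) \<in> ((arcs_ends G)\<^sup>=) ^^ length p"
    by (auto simp: awalk_Cons_iff arcs_ends_conv)
  then show ?case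
    unfolding length_Cons by (rule relpow_Suc_I2)
qed

lemma relpow_reflcl_imp_awalk:
  assumes "(u, v) \<in> ((arcs_ends G)\<^sup>=) ^^ n" "u \<in> verts G"
  shows "\<exists>p. awalk u p v \<and> length p \<le> n"
  using assms
proof (induction n arbitrary: u)
  case 0
  then have "awalk u [] v" by (simp add: awalk_Nil_iff)
  then show ?case by auto
next
  case (Suc n)
  from Suc.prems(1) obtain w where w: "(u, w) \<in> (arcs_ends G)\<^sup>=" "(w, v) \<in> ((arcs_ends G)\<^sup>=) ^^ n"
    by (blast dest: relpow_Suc_D2)
  then have "w \<in> verts G"
    using Suc.prems(2) by (auto dest: adj_in_verts)
  with w(2) Suc.IH obtain q where q: "awalk w q v" "length q \<le> n" by blast
  from w(1) consider (stay) "w = u" | (arc) e where "e \<in> arcs G" "u = tail G e" "w = head G e"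
    by (auto simp: arcs_ends_conv)
  then show ?case
  proof cases
    case stay
    with q show ?thesis by (auto intro: le_SucI)
  next
    case arc
    with q have "awalk u (e # q) v \<and> length (e # q) \<le> Suc n"
      by (simp add: awalk_Cons_iff)
    then show ?thesis by blast
  qed
qed

lemma graph_dist_gt_iff:
  assumes "u \<in> verts G"
  shows "ereal (real r) < graph_dist G u v \<longleftrightarrow> (u, v) \<notin> ((arcs_ends G)\<^sup>=) ^^ r"
proof
  assume far: "ereal (real r) < graph_dist G u v"
  show "(u, v) \<notin> ((arcs_ends G)\<^sup>=) ^^ r"
  proof
    assume "(u, v) \<in> ((arcs_ends G)\<^sup>=) ^^ r"
    then obtain p where "awalk u p v" "length p \<le> r"
      using relpow_reflcl_imp_awalk assms by blast
    with far show False
      by (auto simp: graph_dist_eq[OF wf_digraph_axioms] dest: less_INF_D)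
  qed
next
  assume far: "(u, v) \<notin> ((arcs_ends G)\<^sup>=) ^^ r"
  have "Suc r \<le> length p" if "awalk u p v" for p
    using awalk_imp_relpow_reflcl[OF that] relpow_reflcl_mono[of "length p" r] far
    by (meson not_less_eq_eq subsetD)
  then have "ereal (real (Suc r)) \<le> graph_dist G u v"
    unfolding graph_dist_eq[OF wf_digraph_axioms] by (intro INF_greatest) (simp del: of_nat_Suc)
  then show "ereal (real r) < graph_dist G u v"
    by (rule less_le_trans[rotated]) simp
qed

lemma r_independent_iff_scattered:
  "r_independent r G B \<longleftrightarrow> B \<subseteq> verts G \<and> scattered r (arcs_ends G) B"
  using graph_dist_gt_iff unfolding r_independent_def scattered_def pairwise_def by blast

lemma r_independent_delete_verts_iff_scattered:
  "r_independent r (delete_verts G S) B \<longleftrightarrow>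
    B \<subseteq> verts G - S \<and> scattered r (Restr (arcs_ends G) (verts G - S)) B"
proof -
  interpret D: wf_digraph "delete_verts G S"
    unfolding delete_verts_def by (rule wellformed_induce_subgraph)
  have "arcs_ends (delete_verts G S) = Restr (arcs_ends G) (verts G - S)"
    by (auto simp: delete_verts_def arcs_ends_conv)
  moreover have "verts (delete_verts G S) = verts G - S"
    by (simp add: delete_verts_def)
  ultimately show ?thesis
    by (simp add: D.r_independent_iff_scattered)
qed

end

section \<open>Bicliques\<close>

definition biclique_free :: "nat \<Rightarrow> 'a rel \<Rightarrow> bool" where
  "biclique_free t E \<longleftrightarrow> (\<forall>U W. U \<times> W \<subseteq> E \<longrightarrow> card U < t \<or> card W < t)"

lemma almost_complete_imp_biclique:
  assumes "finite X" "Suc k * t \<le> card X" "t \<le> card Y"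
    and few_misses: "\<And>y. y \<in> Y \<Longrightarrow> card {x \<in> X. (x, y) \<notin> E} \<le> k"
  obtains U W where "U \<times> W \<subseteq> E" "t \<le> card U" "t \<le> card W"
proof -
  obtain W where W: "W \<subseteq> Y" "card W = t" "finite W"
    using obtain_subset_with_card_n[OF assms(3)] by metis
  define Z where "Z = (\<Union>y\<in>W. {x \<in> X. (x, y) \<notin> E})"
  have "card Z \<le> (\<Sum>y\<in>W. card {x \<in> X. (x, y) \<notin> E})"
    unfolding Z_def by (rule card_UN_le[OF W(3)])
  also have "\<dots> \<le> card W * k"
    using sum_bounded_above[of W "\<lambda>y. card {x \<in> X. (x, y) \<notin> E}" k] few_misses W(1) by auto
  finally have "card Z \<le> k * t"
    using W(2) by (simp add: mult.commute)
  moreover have "card X - card Z \<le> card (X - Z)"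
    by (rule diff_card_le_card_Diff) (use assms(1) in \<open>auto simp: Z_def intro: finite_subset\<close>)
  ultimately have "t \<le> card (X - Z)"
    using assms(2) by simp
  moreover have "(X - Z) \<times> W \<subseteq> E"
    by (auto simp: Z_def)
  ultimately show ?thesis
    using that W(2) by blast
qed

lemma (in pair_graph) subgraph_complete_bipartite_iff:
  assumes "0 < m" "0 < n"
  shows "(\<exists>H. subgraph H (with_proj G) \<and> complete_bipartite_digraph m n H) \<longleftrightarrow>
    (\<exists>U W. U \<times> W \<subseteq> parcs G \<and> card U = m \<and> card W = n)"
proof
  assume "\<exists>H. subgraph H (with_proj G) \<and> complete_bipartite_digraph m n H"
  then obtain H U W where "subgraph H (with_proj G)" "card U = m" "card W = n"
      "arcs_ends H = U \<times> W \<union> W \<times> U"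
    unfolding complete_bipartite_digraph_def by blast
  moreover from this(1) have "arcs_ends H \<subseteq> parcs G"
    using arcs_ends_mono[of H "with_proj G"] by simp
  ultimately show "\<exists>U W. U \<times> W \<subseteq> parcs G \<and> card U = m \<and> card W = n" by blast
next
  assume "\<exists>U W. U \<times> W \<subseteq> parcs G \<and> card U = m \<and> card W = n"
  then obtain U W where UW: "U \<times> W \<subseteq> parcs G" "card U = m" "card W = n" by blast
  define H where "H = \<lparr>pverts = U \<union> W, parcs = U \<times> W \<union> W \<times> U\<rparr>"
  have "U \<inter> W = {}"
    using UW(1) pair_no_loops by fastforce
  moreover have "finite U" "finite W"
    using UW(2,3) assms card_gt_0_iff by metis+
  ultimately have H: "complete_bipartite_digraph m n (with_proj H)"
    using UW by (auto simp: complete_bipartite_digraph_pair_def H_def)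
  then interpret H: pair_graph H by (rule pair_graphI_complete_bipartite)
  have "U \<noteq> {}" "W \<noteq> {}"
    using UW(2,3) assms by auto
  then have "U \<union> W \<subseteq> pverts G"
    using UW(1) by (auto dest: wellformed')
  moreover have "parcs H \<subseteq> parcs G"
    using UW(1) arcs_ends_symmetric[OF pair_sym_arcs] by (auto simp: H_def)
  ultimately have "subgraph (with_proj H) (with_proj G)"
    using H.wf_digraph_axioms wf_digraph_axioms by (auto simp: subgraph_def H_def)
  with H show "\<exists>H. subgraph H (with_proj G) \<and> complete_bipartite_digraph m n H" by blast
qed

lemma weakly_sparse_iff_biclique_free:
  assumes "\<forall>G\<in>\<C>. pair_graph G"
  shows "weakly_sparse \<C> \<longleftrightarrow> (\<exists>t\<ge>1. \<forall>G\<in>\<C>. biclique_free t (parcs G))"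
proof -
  have "\<not> (\<exists>H. subgraph H (with_proj G) \<and> complete_bipartite_digraph t t H) \<longleftrightarrow>
      biclique_free t (parcs G)" if "G \<in> \<C>" "1 \<le> t" for G and t :: nat
  proof -
    interpret pair_graph G using assms that(1) by blast
    have "\<exists>U W. U \<times> W \<subseteq> parcs G \<and> card U = t \<and> card W = t"
      if UW: "U \<times> W \<subseteq> parcs G" "t \<le> card U" "t \<le> card W" for U W
    proof -
      obtain U' where "U' \<subseteq> U" "card U' = t"
        using obtain_subset_with_card_n[OF UW(2)] by metis
      moreover obtain W' where "W' \<subseteq> W" "card W' = t"
        using obtain_subset_with_card_n[OF UW(3)] by metis
      ultimately show "\<exists>U W. U \<times> W \<subseteq> parcs G \<and> card U = t \<and> card W = t"
        using UW(1) by blast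
    qed
    then have "(\<exists>U W. U \<times> W \<subseteq> parcs G \<and> card U = t \<and> card W = t) \<longleftrightarrow>
        \<not> biclique_free t (parcs G)"
      unfolding biclique_free_def by (metis not_less order_refl)
    with that(2) show ?thesis
      by (simp add: subgraph_complete_bipartite_iff)
  qed
  then show ?thesis
    unfolding weakly_sparse_def by blast
qed

lemma (in pair_graph) not_r_independent_in_biclique:
  assumes UW: "U \<times> W \<subseteq> parcs G" and B: "B \<subseteq> U - S" "1 < card B" and W: "\<not> W \<subseteq> S"
  shows "\<not> r_independent 2 (delete_verts (with_proj G) S) B"
proof
  let ?E = "Restr (parcs G) (pverts G - S)"
  assume "r_independent 2 (delete_verts (with_proj G) S) B"
  then have scattered: "scattered 2 ?E B"
    by (simp add: r_independent_delete_verts_iff_scattered)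
  obtain x y where xy: "x \<in> B" "y \<in> B" "x \<noteq> y"
    using B(2) by (metis One_nat_def card_le_Suc0_iff_eq card.infinite not_less zero_le)
  obtain z where z: "z \<in> W" "z \<notin> S"
    using W by blast
  have arcs: "(x, z) \<in> ?E" "(y, z) \<in> ?E"
    using xy z UW B(1) by (auto dest: wellformed')
  moreover from arcs(2) have "(z, y) \<in> ?E"
    using arcs_ends_symmetric[OF pair_sym_arcs] by auto
  ultimately have "(x, y) \<in> (?E\<^sup>=) ^^ 2"
    by (auto simp: numeral_2_eq_2)
  with scattered xy show False
    using scatteredD by metis
qed

section \<open>Complementing adjacency between cells\<close>

lemma pigeonhole_card_less:
  assumes "f \<in> A \<rightarrow> B" "finite A" "finite B" "card B * n < card A"
  shows "\<exists>y\<in>B. n < card {x \<in> A. f x = y}"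
proof -
  have "A \<noteq> {}"
    using assms(4) by auto
  then have "B \<noteq> {}"
    using assms(1) by auto
  then obtain y where y: "y \<in> B" "card A \<le> card (f -` {y} \<inter> A) * card B"
    using pigeonhole_card assms(1-3) by blast
  with assms(4) have "n * card B < card (f -` {y} \<inter> A) * card B"
    by (metis less_le_trans mult.commute)
  then have "n < card (f -` {y} \<inter> A)"
    by simp
  moreover have "f -` {y} \<inter> A = {x \<in> A. f x = y}" by blast
  ultimately show ?thesis
    using y(1) by auto
qed

locale cellwise_flip =
  fixes V :: "'a set" and E E' :: "'a rel" and p :: "'a \<Rightarrow> 'c" and T :: "'c \<Rightarrow> 'c \<Rightarrow> bool"
  assumes finite_V: "finite V"
    and E'_subset: "E' \<subseteq> V \<times> V"
    and sym_E': "sym E'"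
    and flipped_iff: "u \<in> V \<Longrightarrow> v \<in> V \<Longrightarrow> u \<noteq> v \<Longrightarrow> (u, v) \<in> E' \<longleftrightarrow> ((u, v) \<in> E) \<noteq> T (p u) (p v)"
begin

definition cell :: "'c \<Rightarrow> 'a set" where
  "cell c = {v \<in> V. p v = c}"

definition small_cells :: "nat \<Rightarrow> 'a set" where
  "small_cells t = {v \<in> V. card (cell (p v)) < t}"

definition ball :: "nat \<Rightarrow> 'a \<Rightarrow> 'a set" where
  "ball r b = ((E'\<^sup>=) ^^ r) `` {b}"

lemma small_cells_subset: "small_cells t \<subseteq> V"
  by (auto simp: small_cells_def)

lemma card_small_cells_le: "card (small_cells t) \<le> t * card (p ` V)"
proof -
  define C where "C = {c \<in> p ` V. card (cell c) < t}"
  have "small_cells t = (\<Union>c\<in>C. cell c)"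
    by (auto simp: small_cells_def cell_def C_def)
  also have "card \<dots> \<le> (\<Sum>c\<in>C. card (cell c))"
    by (rule card_UN_le) (use finite_V in \<open>simp add: C_def\<close>)
  also have "\<dots> \<le> card C * t"
    using sum_bounded_above[of C "\<lambda>c. card (cell c)" t] by (auto simp: C_def)
  also have "\<dots> \<le> t * card (p ` V)"
    using finite_V card_mono[of "p ` V" C] by (auto simp: C_def mult.commute)
  finally show ?thesis .
qed

lemma ball_subset: "b \<in> V \<Longrightarrow> ball r b \<subseteq> V"
  using relpow_reflcl_closed[of E' V b] E'_subset by (auto simp: ball_def)

text \<open>A vertex of \<open>cell d\<close> that misses some element of \<open>X\<close> in \<open>E\<close> is equal or \<open>E'\<close>-adjacent to it,
  which happens for at most one element of the scattered set \<open>X\<close>.\<close>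

lemma card_cell_less:
  assumes "biclique_free t E" "X \<subseteq> cell c" "scattered 2 E' X" "2 * t \<le> card X" "T c d"
  shows "card (cell d) < t"
proof (rule ccontr)
  assume "\<not> card (cell d) < t"
  have finX: "finite X"
    using assms(2) finite_V by (auto simp: cell_def intro: finite_subset)
  have "card {x \<in> X. (x, y) \<notin> E} \<le> 1" if "y \<in> cell d" for y
  proof -
    have "{x \<in> X. (x, y) \<notin> E} \<subseteq> {x \<in> X. (x, y) \<in> E'\<^sup>=}"
      using assms(2,5) that flipped_iff by (auto simp: cell_def)
    then have "card {x \<in> X. (x, y) \<notin> E} \<le> card {x \<in> X. (x, y) \<in> E'\<^sup>=}"
      using finX by (intro card_mono) auto
    with card_neighbours_in_scattered_le[OF sym_E' assms(3)] show ?thesis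
      by (rule order_trans[rotated])
  qed
  then obtain U W where "U \<times> W \<subseteq> E" "t \<le> card U" "t \<le> card W"
    using almost_complete_imp_biclique[OF finX, of 1 t "cell d" E] assms(4) \<open>\<not> card (cell d) < t\<close>
    by auto
  with assms(1) show False
    by (auto simp: biclique_free_def not_less[symmetric])
qed

lemma scattered_outside_small_cells:
  assumes "biclique_free t E" "B \<subseteq> V" "scattered (2 * r + 2) E' B" "2 * t \<le> card B"
    and same_cells: "\<And>b. b \<in> B \<Longrightarrow> p ` ball r b = K"
  shows "scattered r (Restr E (V - small_cells t)) (B - small_cells t)"
proof (rule scattered_transfer)
  show "scattered r E' (B - small_cells t)"
    using assms(3) by (rule scattered_subset[OF scattered_antimono]) auto
next
  fix b x y
  assume b: "b \<in> B - small_cells t" "(b, x) \<in> (E'\<^sup>=) ^^ r"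
    and xy: "(x, y) \<in> Restr E (V - small_cells t)"
  from b have "p x \<in> K"
    using same_cells[of b] by (auto simp: ball_def)
  then have "\<exists>z. z \<in> ball r b' \<and> p z = p x" if "b' \<in> B" for b'
    using same_cells[OF that] by auto
  then obtain f where f: "\<And>b'. b' \<in> B \<Longrightarrow> f b' \<in> ball r b'" "\<And>b'. b' \<in> B \<Longrightarrow> p (f b') = p x"
    by metis
  have "scattered (r + 2 + r) E' B"
    using assms(3) by (simp add: mult_2 add.commute add.left_commute)
  from scattered_nearby_image[OF sym_E' this, of f] f(1)
  have "inj_on f B" "scattered 2 E' (f ` B)"
    by (auto simp: ball_def)
  moreover have "f ` B \<subseteq> cell (p x)"
    using f ball_subset assms(2) by (fastforce simp: cell_def)
  ultimately have "T (p x) (p y) \<Longrightarrow> card (cell (p y)) < t"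
    using card_cell_less assms(1,4) by (metis card_image)
  with xy have "\<not> T (p x) (p y)"
    by (auto simp: small_cells_def)
  with xy show "(x, y) \<in> E'\<^sup>="
    using flipped_iff[of x y] by auto
qed

lemma ex_scattered_outside_small_cells:
  assumes "biclique_free t E" "B \<subseteq> V" "scattered (2 * r + 2) E' B"
    and large: "2 ^ card (p ` V) * (2 * t + t * card (p ` V) + m) < card B"
  obtains B' where "B' \<subseteq> B - small_cells t" "m < card B'"
    "scattered r (Restr E (V - small_cells t)) B'"
proof -
  have finB: "finite B"
    using assms(2) finite_V by (rule finite_subset)
  have "(\<lambda>b. p ` ball r b) \<in> B \<rightarrow> Pow (p ` V)"
    using ball_subset assms(2) by blast
  then have "\<exists>K\<in>Pow (p ` V). 2 * t + t * card (p ` V) + m < card {b \<in> B. p ` ball r b = K}"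
    by (rule pigeonhole_card_less) (use finB finite_V large in \<open>simp_all add: card_Pow\<close>)
  then obtain K where K: "2 * t + t * card (p ` V) + m < card {b \<in> B. p ` ball r b = K}" by blast
  define B\<^sub>K where "B\<^sub>K = {b \<in> B. p ` ball r b = K}"
  have "B\<^sub>K \<subseteq> B"
    by (auto simp: B\<^sub>K_def)
  moreover have "scattered r (Restr E (V - small_cells t)) (B\<^sub>K - small_cells t)"
  proof (rule scattered_outside_small_cells[OF assms(1)])
    show "scattered (2 * r + 2) E' B\<^sub>K"
      using assms(3) \<open>B\<^sub>K \<subseteq> B\<close> by (rule scattered_subset)
  qed (use assms(2) K in \<open>auto simp: B\<^sub>K_def\<close>)
  moreover have "m < card (B\<^sub>K - small_cells t)"
  proof -
    have "finite (small_cells t)"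
      using small_cells_subset finite_V by (rule finite_subset)
    from diff_card_le_card_Diff[OF this, of B\<^sub>K] show ?thesis
      using K card_small_cells_le[of t] by (simp add: B\<^sub>K_def)
  qed
  ultimately show ?thesis
    using that by blast
qed

end

section \<open>Flips\<close>

lemma parcs_flips_iff:
  assumes "finite \<F>" "u \<noteq> v"
  shows "(u, v) \<in> parcs (flips \<F> G) \<longleftrightarrow>
    ((u, v) \<in> parcs G) \<noteq> odd (card {F \<in> \<F>. (u, v) \<in> fst F \<times> snd F \<union> snd F \<times> fst F})"
  using assms
proof (induction \<F> rule: finite_induct)
  case (insert F \<F>)
  let ?toggles = "\<lambda>F. (u, v) \<in> fst F \<times> snd F \<union> snd F \<times> fst F"
  have "{F' \<in> insert F \<F>. ?toggles F'} =
      (if ?toggles F then insert F {F' \<in> \<F>. ?toggles F'} else {F' \<in> \<F>. ?toggles F'})"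
    by auto
  then have "odd (card {F' \<in> insert F \<F>. ?toggles F'}) \<longleftrightarrow>
      odd (card {F' \<in> \<F>. ?toggles F'}) \<noteq> ?toggles F"
    using insert.hyps by simp
  moreover have "(u, v) \<in> parcs (flips (insert F \<F>) G) \<longleftrightarrow>
      ((u, v) \<in> parcs (flips \<F> G)) \<noteq> ?toggles F"
    using insert.hyps \<open>u \<noteq> v\<close> by (auto simp: flips_insert flip_def)
  ultimately show ?case
    using insert.IH[OF \<open>u \<noteq> v\<close>] by blast
qed simp

definition flip_profile ::
    "('a set \<times> 'a set) set \<Rightarrow> 'a \<Rightarrow> ('a set \<times> 'a set) set \<times> ('a set \<times> 'a set) set" where
  "flip_profile \<F> v = ({F \<in> \<F>. v \<in> fst F}, {F \<in> \<F>. v \<in> snd F})"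

definition flipped_profiles :: "'b set \<times> 'b set \<Rightarrow> 'b set \<times> 'b set \<Rightarrow> bool" where
  "flipped_profiles c d \<longleftrightarrow> odd (card (fst c \<inter> snd d \<union> snd c \<inter> fst d))"

lemma card_flip_profile_image_le:
  assumes "finite \<F>"
  shows "card (flip_profile \<F> ` V) \<le> 4 ^ card \<F>"
proof -
  have "flip_profile \<F> ` V \<subseteq> Pow \<F> \<times> Pow \<F>"
    by (auto simp: flip_profile_def)
  then have "card (flip_profile \<F> ` V) \<le> card (Pow \<F> \<times> Pow \<F>)"
    using assms by (intro card_mono) auto
  also have "\<dots> = 4 ^ card \<F>"
    using assms by (simp add: card_cartesian_product card_Pow flip: power_mult_distrib)
  finally show ?thesis .
qed

lemma (in pair_graph) cellwise_flip_flips: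
  assumes "finite \<F>" "\<forall>F\<in>\<F>. is_flip G F"
  shows "cellwise_flip (pverts G) (parcs G) (parcs (flips \<F> G)) (flip_profile \<F>) flipped_profiles"
proof -
  have G': "pair_graph (flips \<F> G)" "pverts (flips \<F> G) = pverts G"
    using pair_graph_flips[OF assms(1) pair_graph_axioms assms(2)] by auto
  interpret G': pair_graph "flips \<F> G" by fact
  show ?thesis
  proof
    show "parcs (flips \<F> G) \<subseteq> pverts G \<times> pverts G"
      using G'.wellformed' G'(2) by auto
    show "sym (parcs (flips \<F> G))"
      using G'.pair_sym_arcs by (simp add: symmetric_def)
    fix u v :: 'a assume "u \<noteq> v"
    moreover have "{F \<in> \<F>. (u, v) \<in> fst F \<times> snd F \<union> snd F \<times> fst F} =
        fst (flip_profile \<F> u) \<inter> snd (flip_profile \<F> v) \<union>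
        snd (flip_profile \<F> u) \<inter> fst (flip_profile \<F> v)"
      by (auto simp: flip_profile_def)
    ultimately show "(u, v) \<in> parcs (flips \<F> G) \<longleftrightarrow>
        ((u, v) \<in> parcs G) \<noteq> flipped_profiles (flip_profile \<F> u) (flip_profile \<F> v)"
      using parcs_flips_iff[OF assms(1)] by (simp add: flipped_profiles_def)
  qed (rule pair_finite_verts)
qed

text \<open>Neighbours inside \<open>S\<close> are left out, since such an edge would be flipped from both ends.\<close>

definition isolating_flips :: "'a pair_pre_digraph \<Rightarrow> 'a set \<Rightarrow> ('a set \<times> 'a set) set" where
  "isolating_flips G S = (\<lambda>v. ({v}, parcs G `` {v} - S)) ` S"

lemma finite_isolating_flips: "finite S \<Longrightarrow> finite (isolating_flips G S)"
  by (simp add: isolating_flips_def)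

lemma card_isolating_flips_le: "finite S \<Longrightarrow> card (isolating_flips G S) \<le> card S"
  unfolding isolating_flips_def by (rule card_image_le)

lemma (in pair_graph) is_flip_isolating_flips:
  "S \<subseteq> pverts G \<Longrightarrow> F \<in> isolating_flips G S \<Longrightarrow> is_flip G F"
  by (auto simp: isolating_flips_def is_flip_def dest: wellformed')

lemma (in pair_graph) parcs_isolating_flips_iff:
  assumes "finite S" "u \<notin> S" "u \<noteq> v"
  shows "(u, v) \<in> parcs (flips (isolating_flips G S) G) \<longleftrightarrow> (u, v) \<in> parcs G \<and> v \<notin> S"
proof -
  have "{F \<in> isolating_flips G S. (u, v) \<in> fst F \<times> snd F \<union> snd F \<times> fst F} =
      (if v \<in> S \<and> (v, u) \<in> parcs G then {({v}, parcs G `` {v} - S)} else {})"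
    using assms(2) by (auto simp: isolating_flips_def)
  moreover have "(v, u) \<in> parcs G \<longleftrightarrow> (u, v) \<in> parcs G"
    using arcs_ends_symmetric[OF pair_sym_arcs] by auto
  ultimately show ?thesis
    using assms(3) finite_isolating_flips[OF assms(1), of G] by (auto simp: parcs_flips_iff)
qed

section \<open>Independent subsets of large sets\<close>

definition has_flip_independent_subset ::
    "nat \<Rightarrow> nat \<Rightarrow> nat \<Rightarrow> 'a pair_pre_digraph \<Rightarrow> 'a set \<Rightarrow> bool" where
  "has_flip_independent_subset s r m G A \<longleftrightarrow>
    (\<exists>\<F> B. finite \<F> \<and> card \<F> \<le> s \<and> (\<forall>F\<in>\<F>. is_flip G F) \<and>
      B \<subseteq> A \<and> card B \<ge> m \<and> r_independent r (with_proj (flips \<F> G)) B)"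

definition has_deletion_independent_subset ::
    "nat \<Rightarrow> nat \<Rightarrow> nat \<Rightarrow> 'a pair_pre_digraph \<Rightarrow> 'a set \<Rightarrow> bool" where
  "has_deletion_independent_subset s r m G A \<longleftrightarrow>
    (\<exists>S B. S \<subseteq> pverts G \<and> card S \<le> s \<and>
      B \<subseteq> A - S \<and> card B > m \<and> r_independent r (delete_verts (with_proj G) S) B)"

context pair_graph
begin

lemma r_independent_isolating_flips:
  assumes "S \<subseteq> pverts G" "r_independent r (delete_verts (with_proj G) S) B"
  shows "r_independent r (with_proj (flips (isolating_flips G S) G)) B"
proof -
  let ?\<F> = "isolating_flips G S"
  have finS: "finite S"
    using assms(1) pair_finite_verts by (rule finite_subset)
  have G': "pair_graph (flips ?\<F> G)" "pverts (flips ?\<F> G) = pverts G"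
    using pair_graph_flips[OF finite_isolating_flips[OF finS] pair_graph_axioms]
      is_flip_isolating_flips[OF assms(1)] by auto
  interpret G': pair_graph "flips ?\<F> G" by fact
  from assms(2) have B: "B \<subseteq> pverts G - S" "scattered r (Restr (parcs G) (pverts G - S)) B"
    by (simp_all add: r_independent_delete_verts_iff_scattered)
  from B(2) have "scattered r (parcs (flips ?\<F> G)) B"
  proof (rule scattered_transfer)
    fix b x y
    assume "b \<in> B" "(b, x) \<in> ((Restr (parcs G) (pverts G - S))\<^sup>=) ^^ r"
      and xy: "(x, y) \<in> parcs (flips ?\<F> G)"
    then have "x \<in> pverts G - S"
      using B(1) relpow_reflcl_closed[of "Restr (parcs G) (pverts G - S)" "pverts G - S" b x r]
      by auto
    with xy show "(x, y) \<in> (Restr (parcs G) (pverts G - S))\<^sup>="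
      using parcs_isolating_flips_iff[OF finS, of x y] by (auto dest: wellformed')
  qed
  with B(1) show "r_independent r (with_proj (flips ?\<F> G)) B"
    using G'(2) by (auto simp: G'.r_independent_iff_scattered)
qed

lemma deletion_imp_flip_independent_subset:
  assumes "has_deletion_independent_subset s r m G A"
  shows "has_flip_independent_subset s r m G A"
proof -
  obtain S B where S: "S \<subseteq> pverts G" "card S \<le> s" and B: "B \<subseteq> A - S" "m < card B"
      and ind: "r_independent r (delete_verts (with_proj G) S) B"
    using assms unfolding has_deletion_independent_subset_def by blast
  have finS: "finite S"
    using S(1) pair_finite_verts by (rule finite_subset)
  have "card (isolating_flips G S) \<le> s"
    using card_isolating_flips_le[OF finS] S(2) by (rule order_trans)
  with finite_isolating_flips[OF finS] is_flip_isolating_flips[OF S(1)]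
    r_independent_isolating_flips[OF S(1) ind] B show ?thesis
    unfolding has_flip_independent_subset_def
    by (intro exI[of _ "isolating_flips G S"] exI[of _ B]) auto
qed

lemma flip_imp_deletion_independent_subset:
  assumes "biclique_free t (parcs G)"
    and "has_flip_independent_subset s (2 * r + 2)
      (Suc (2 ^ 4 ^ s * (2 * t + t * 4 ^ s + m))) G A"
  shows "has_deletion_independent_subset (t * 4 ^ s) r m G A"
proof -
  obtain \<F> B where \<F>: "finite \<F>" "card \<F> \<le> s" "\<forall>F\<in>\<F>. is_flip G F"
    and B: "B \<subseteq> A" "2 ^ 4 ^ s * (2 * t + t * 4 ^ s + m) < card B"
    and ind: "r_independent (2 * r + 2) (with_proj (flips \<F> G)) B"
    using assms(2) unfolding has_flip_independent_subset_def Suc_le_eq by blast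
  interpret cellwise_flip "pverts G" "parcs G" "parcs (flips \<F> G)" "flip_profile \<F>" flipped_profiles
    by (rule cellwise_flip_flips[OF \<F>(1,3)])
  have G': "pair_graph (flips \<F> G)" "pverts (flips \<F> G) = pverts G"
    using pair_graph_flips[OF \<F>(1) pair_graph_axioms \<F>(3)] by auto
  interpret G': pair_graph "flips \<F> G" by fact
  let ?k = "card (flip_profile \<F> ` pverts G)"
  have k: "?k \<le> 4 ^ s"
    using card_flip_profile_image_le[OF \<F>(1)] power_increasing[OF \<F>(2), of "4 :: nat"]
    by (meson one_le_numeral order_trans)
  then have "2 ^ ?k * (2 * t + t * ?k + m) \<le> 2 ^ 4 ^ s * (2 * t + t * 4 ^ s + m)"
    by (intro mult_mono add_mono power_increasing) auto
  then have "2 ^ ?k * (2 * t + t * ?k + m) < card B"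
    using B(2) by (rule le_less_trans)
  moreover have "B \<subseteq> pverts G" "scattered (2 * r + 2) (parcs (flips \<F> G)) B"
    using ind G'(2) by (simp_all add: G'.r_independent_iff_scattered)
  ultimately obtain B' where B': "B' \<subseteq> B - small_cells t" "m < card B'"
      "scattered r (Restr (parcs G) (pverts G - small_cells t)) B'"
    using ex_scattered_outside_small_cells[OF assms(1)] by metis
  then have "r_independent r (delete_verts (with_proj G) (small_cells t)) B'"
    using \<open>B \<subseteq> pverts G\<close> by (auto simp: r_independent_delete_verts_iff_scattered)
  moreover have "card (small_cells t) \<le> t * 4 ^ s"
    using card_small_cells_le[of t] k by (meson mult_le_mono2 order_trans)
  ultimately show ?thesis
    unfolding has_deletion_independent_subset_def using B' B(1) small_cells_subset
    by (intro exI[of _ "small_cells t"] exI[of _ B']) auto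
qed

end

definition on_large_sets ::
    "'a pair_pre_digraph set \<Rightarrow> (nat \<Rightarrow> 'a pair_pre_digraph \<Rightarrow> 'a set \<Rightarrow> bool) \<Rightarrow> bool" where
  "on_large_sets \<C> P \<longleftrightarrow>
    (\<exists>N \<in> {1::nat..} \<rightarrow> {1::nat..}. \<forall>m\<ge>1. \<forall>G\<in>\<C>. \<forall>A\<subseteq>pverts G. N m \<le> card A \<longrightarrow> P m G A)"

lemma on_large_sets_mono:
  assumes "on_large_sets \<C> P" "\<And>m. 1 \<le> m \<Longrightarrow> 1 \<le> f m"
    and "\<And>m G A. G \<in> \<C> \<Longrightarrow> P (f m) G A \<Longrightarrow> Q m G A"
  shows "on_large_sets \<C> Q"
proof -
  obtain N where N: "N \<in> {1::nat..} \<rightarrow> {1::nat..}"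
    "\<forall>m\<ge>1. \<forall>G\<in>\<C>. \<forall>A\<subseteq>pverts G. N m \<le> card A \<longrightarrow> P m G A"
    using assms(1) unfolding on_large_sets_def by blast
  show ?thesis
    unfolding on_large_sets_def
  proof (intro bexI[of _ "N \<circ> f"])
    show "N \<circ> f \<in> {1..} \<rightarrow> {1..}"
      using N(1) assms(2) by (auto simp: Pi_iff)
  qed (use N(2) assms(2,3) in auto)
qed

lemma strongly_flip_flat_iff:
  "strongly_flip_flat \<C> \<longleftrightarrow> (\<exists>s. \<forall>r\<ge>1. on_large_sets \<C> (has_flip_independent_subset s r))"
  by (simp add: strongly_flip_flat_def on_large_sets_def has_flip_independent_subset_def)

lemma uniformly_almost_wide_iff:
  "uniformly_almost_wide \<C> \<longleftrightarrow>
    (\<exists>s. \<forall>r\<ge>1. on_large_sets \<C> (has_deletion_independent_subset s r))"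
  by (simp add: uniformly_almost_wide_def on_large_sets_def has_deletion_independent_subset_def)

lemma weakly_sparse_if_uniformly_almost_wide:
  assumes \<C>: "\<forall>G\<in>\<C>. pair_graph G" and "uniformly_almost_wide \<C>"
  shows "weakly_sparse \<C>"
proof -
  obtain s where "on_large_sets \<C> (has_deletion_independent_subset s 2)"
    using assms(2) unfolding uniformly_almost_wide_iff by (metis one_le_numeral)
  then obtain N where wide: "\<And>G A. G \<in> \<C> \<Longrightarrow> A \<subseteq> pverts G \<Longrightarrow> N 1 \<le> card A \<Longrightarrow>
      has_deletion_independent_subset s 2 1 G A"
    unfolding on_large_sets_def by (metis order_refl)
  have "biclique_free (N 1 + Suc s) (parcs G)" if G: "G \<in> \<C>" for G
    unfolding biclique_free_def
  proof (intro allI impI, rule ccontr)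
    interpret pair_graph G using \<C> G by blast
    fix U W assume UW: "U \<times> W \<subseteq> parcs G" "\<not> (card U < N 1 + Suc s \<or> card W < N 1 + Suc s)"
    then have "W \<noteq> {}" by auto
    then have "U \<subseteq> pverts G"
      using UW(1) by (auto dest: wellformed')
    with UW(2) obtain S B where S: "S \<subseteq> pverts G" "card S \<le> s"
      and B: "B \<subseteq> U - S" "1 < card B" "r_independent 2 (delete_verts (with_proj G) S) B"
      using wide[OF G, of U] unfolding has_deletion_independent_subset_def by auto
    have "finite S"
      using S(1) pair_finite_verts by (rule finite_subset)
    with S(2) UW(2) have "\<not> W \<subseteq> S"
      using card_mono[of S W] by auto
    with UW(1) B show False
      using not_r_independent_in_biclique by blast
  qed
  then show ?thesis
    unfolding weakly_sparse_iff_biclique_free[OF \<C>] by (intro exI[of _ "N 1 + Suc s"]) auto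
qed

lemma strongly_flip_flat_if_uniformly_almost_wide:
  assumes "\<forall>G\<in>\<C>. pair_graph G" "uniformly_almost_wide \<C>"
  shows "strongly_flip_flat \<C>"
proof -
  have "on_large_sets \<C> (has_flip_independent_subset s r)"
    if "on_large_sets \<C> (has_deletion_independent_subset s r)" for s r
    using that
    by (rule on_large_sets_mono[where f = id])
      (use assms(1) in \<open>auto intro: pair_graph.deletion_imp_flip_independent_subset\<close>)
  with assms(2) show ?thesis
    unfolding uniformly_almost_wide_iff strongly_flip_flat_iff by blast
qed

lemma uniformly_almost_wide_if_strongly_flip_flat:
  assumes \<C>: "\<forall>G\<in>\<C>. pair_graph G" and "weakly_sparse \<C>" "strongly_flip_flat \<C>"
  shows "uniformly_almost_wide \<C>"
proof -
  obtain t where t: "\<forall>G\<in>\<C>. biclique_free t (parcs G)"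
    using assms(2) weakly_sparse_iff_biclique_free[OF \<C>] by blast
  obtain s where s: "\<And>r. 1 \<le> r \<Longrightarrow> on_large_sets \<C> (has_flip_independent_subset s r)"
    using assms(3) unfolding strongly_flip_flat_iff by blast
  have "on_large_sets \<C> (has_deletion_independent_subset (t * 4 ^ s) r)" for r
  proof (rule on_large_sets_mono)
    show "on_large_sets \<C> (has_flip_independent_subset s (2 * r + 2))"
      by (rule s) simp
    show "has_deletion_independent_subset (t * 4 ^ s) r m G A"
      if "G \<in> \<C>" "has_flip_independent_subset s (2 * r + 2)
        (Suc (2 ^ 4 ^ s * (2 * t + t * 4 ^ s + m))) G A" for m G A
      using that \<C> t by (blast intro: pair_graph.flip_imp_deletion_independent_subset)
  qed simp
  then show ?thesis
    unfolding uniformly_almost_wide_iff by blast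
qed

theorem mainTheorem1:
  fixes \<C> :: "'a pair_pre_digraph set"
  assumes "\<forall>G\<in>\<C>. pair_graph G"
  shows "weakly_sparse \<C> \<and> strongly_flip_flat \<C> \<longleftrightarrow> uniformly_almost_wide \<C>"
  using uniformly_almost_wide_if_strongly_flip_flat weakly_sparse_if_uniformly_almost_wide
    strongly_flip_flat_if_uniformly_almost_wide assms by blast

end
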